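(* Let $(\mathfrak g,\varphi_i,\xi_i,\eta_i)$ be an almost $3$-contact Lie algebra with abelian structure such that the endomorphism $\psi:\mathfrak h\to\mathfrak h$ is invertible. Then the vertical subspace $\mathfrak v$ is a subalgebra isomorphic to $\mathfrak{so}(3)$, $\mathfrak h$ is an abelian ideal, and the non-zero brackets are given by $$[\xi_i,\xi_j]=2\delta\xi_k,\qquad[\xi_i,X]=\delta\varphi_iX,$$ for any even permutation $(i,j,k)$ of $(1,2,3)$, $X\in\mathfrak h$ and some $\delta\neq0$. That is, $\mathfrak g\cong\mathfrak{so}(3)\ltimes_\rho\mathbb R^{4n}$, where $\rho:\mathfrak{so}(3)\to\mathfrak{gl}(4n,\mathbb R)$ is a representation of $\mathfrak{so}(3)$ such that $\{\delta^{-1}\rho(\xi_i):i=1,2,3\}$ is a hypercomplex structure on $\mathbb R^{4n}$.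
   Context: An almost contact structure on a real Lie algebra $\mathfrak g$ is a triple $(\varphi,\xi,\eta)$, $\varphi\in\mathrm{End}(\mathfrak g)$, $\xi\in\mathfrak g$, $\eta\in\mathfrak g^*$, with $\varphi^2=-I+\eta\otimes\xi$ and $\eta(\xi)=1$. It is abelian if $\mathrm{ad}_\xi\circ\varphi=\varphi\circ\mathrm{ad}_\xi$ and $[\varphi X,\varphi Y]=[X,Y]$ for all $X,Y\in\operatorname{Ker}\eta$. An almost $3$-contact Lie algebra is a real Lie algebra $\mathfrak g$ of dimension $4n+3$, $n\ge1$, with three almost contact structures $(\varphi_i,\xi_i,\eta_i)$, $i=1,2,3$, such that for every even permutation $(i,j,k)$ of $(1,2,3)$: $\varphi_k=\varphi_i\varphi_j-\eta_j\otimes\xi_i=-\varphi_j\varphi_i+\eta_i\otimes\xi_j$, $\xi_k=\varphi_i\xi_j=-\varphi_j\xi_i$, $\eta_k=\eta_i\circ\varphi_j=-\eta_j\circ\varphi_i$. It is abelian if each $(\varphi_i,\xi_i,\eta_i)$ is abelian. Set $\mathfrak h=\bigcap_i\operatorname{Ker}\eta_i$ and $\mathfrak v=\langle\xi_1,\xi_2,\xi_3\rangle$. For an abelian structure, $\psi:=(\mathrm{ad}_{\xi_i}\circ\varphi_i)|_{\mathfrak h}=(\varphi_i\circ\mathrm{ad}_{\xi_i})|_{\mathfrak h}:\mathfrak h\to\mathfrak h$ is well defined, independently of $i$. A hypercomplex structure on the abelian Lie algebra $\mathbb R^{4n}$ is a triple of endomorphisms $J_1,J_2,J_3$ with $J_i^2=-I$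 and $J_1J_2=-J_2J_1=J_3$. *)

theory Defs
  imports "HOL-Analysis.Analysis" "HOL-Combinatorics.Permutations"
begin

section \<open>Lie algebras\<close>

definition lie_algebra :: "('a::real_vector \<Rightarrow> 'a \<Rightarrow> 'a) \<Rightarrow> bool" where
  "lie_algebra br \<longleftrightarrow>
     bilinear br \<and>
     (\<forall>x. br x x = 0) \<and>
     (\<forall>x y z. br x (br y z) + br y (br z x) + br z (br x y) = 0)"

definition lie_subalgebra :: "('a::real_vector \<Rightarrow> 'a \<Rightarrow> 'a) \<Rightarrow> 'a set \<Rightarrow> bool" where
  "lie_subalgebra br L \<longleftrightarrow> subspace L \<and> (\<forall>x\<in>L. \<forall>y\<in>L. br x y \<in> L)"

definition lie_ideal :: "('a::real_vector \<Rightarrow> 'a \<Rightarrow> 'a) \<Rightarrow> 'a set \<Rightarrow> bool" where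
  "lie_ideal br I \<longleftrightarrow> subspace I \<and> (\<forall>x. \<forall>y\<in>I. br x y \<in> I)"

definition abelian_on :: "('a::real_vector \<Rightarrow> 'a \<Rightarrow> 'a) \<Rightarrow> 'a set \<Rightarrow> bool" where
  "abelian_on br L \<longleftrightarrow> (\<forall>x\<in>L. \<forall>y\<in>L. br x y = 0)"

text \<open>Homomorphisms and isomorphisms between Lie algebras given by a carrier subspace of an
  ambient vector space; the values of \<open>f\<close> outside the carrier \<open>L\<close> are irrelevant.\<close>

definition lie_hom ::
  "'a::real_vector set \<Rightarrow> ('a \<Rightarrow> 'a \<Rightarrow> 'a) \<Rightarrow> 'b::real_vector set \<Rightarrow> ('b \<Rightarrow> 'b \<Rightarrow> 'b) \<Rightarrow>
   ('a \<Rightarrow> 'b) \<Rightarrow> bool" where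
  "lie_hom L br M br' f \<longleftrightarrow>
     (\<forall>x\<in>L. f x \<in> M) \<and>
     (\<forall>x\<in>L. \<forall>y\<in>L. f (x + y) = f x + f y) \<and>
     (\<forall>c. \<forall>x\<in>L. f (c *\<^sub>R x) = c *\<^sub>R f x) \<and>
     (\<forall>x\<in>L. \<forall>y\<in>L. f (br x y) = br' (f x) (f y))"

definition lie_iso ::
  "'a::real_vector set \<Rightarrow> ('a \<Rightarrow> 'a \<Rightarrow> 'a) \<Rightarrow> 'b::real_vector set \<Rightarrow> ('b \<Rightarrow> 'b \<Rightarrow> 'b) \<Rightarrow>
   ('a \<Rightarrow> 'b) \<Rightarrow> bool" where
  "lie_iso L br M br' f \<longleftrightarrow> lie_hom L br M br' f \<and> bij_betw f L M"

definition commutator :: "real^'m^'m \<Rightarrow> real^'m^'m \<Rightarrow> real^'m^'m" where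
  "commutator A B = A ** B - B ** A"

definition so3 :: "(real^3^3) set" where
  "so3 = {A. Finite_Cartesian_Product.transpose A = - A}"

text \<open>Representations of \<open>so3\<close> on \<open>real^'m\<close>, i.e. Lie algebra homomorphisms into
  \<open>gl(CARD('m), \<real>)\<close>, which is the space of all square matrices with the commutator.\<close>

definition so3_representation :: "(real^3^3 \<Rightarrow> real^'m^'m) \<Rightarrow> bool" where
  "so3_representation \<rho> \<longleftrightarrow> lie_hom so3 commutator UNIV commutator \<rho>"

text \<open>The bracket of the semidirect product of \<open>so3\<close> with the abelian Lie algebra \<open>real^'m\<close>;
  its carrier is \<open>so3 \<times> UNIV\<close>.\<close>

definition semidirect_bracket ::
  "(real^3^3 \<Rightarrow> real^'m^'m) \<Rightarrow> (real^3^3) \<times> (real^'m) \<Rightarrow> (real^3^3) \<times> (real^'m) \<Rightarrow>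
   (real^3^3) \<times> (real^'m)" where
  "semidirect_bracket \<rho> p q =
     (commutator (fst p) (fst q), \<rho> (fst p) *v snd q - \<rho> (fst q) *v snd p)"

text \<open>On an abelian Lie algebra every complex structure is integrable, so no bracket occurs.\<close>

definition hypercomplex_structure :: "(nat \<Rightarrow> 'b::real_vector \<Rightarrow> 'b) \<Rightarrow> bool" where
  "hypercomplex_structure J \<longleftrightarrow>
     (\<forall>i\<in>{1,2,3}. linear (J i) \<and> (\<forall>x. J i (J i x) = - x)) \<and>
     (\<forall>x. J 1 (J 2 x) = - J 2 (J 1 x)) \<and>
     (\<forall>x. J 1 (J 2 x) = J 3 x)"


section \<open>Almost 3-contact Lie algebras\<close>

definition almost_contact ::
  "('a::real_vector \<Rightarrow> 'a) \<Rightarrow> 'a \<Rightarrow> ('a \<Rightarrow> real) \<Rightarrow> bool" where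
  "almost_contact \<phi> \<xi> \<eta> \<longleftrightarrow>
     linear \<phi> \<and> linear \<eta> \<and> (\<forall>x. \<phi> (\<phi> x) = - x + \<eta> x *\<^sub>R \<xi>) \<and> \<eta> \<xi> = 1"

definition abelian_almost_contact ::
  "('a::real_vector \<Rightarrow> 'a \<Rightarrow> 'a) \<Rightarrow> ('a \<Rightarrow> 'a) \<Rightarrow> 'a \<Rightarrow> ('a \<Rightarrow> real) \<Rightarrow> bool" where
  "abelian_almost_contact br \<phi> \<xi> \<eta> \<longleftrightarrow>
     br \<xi> \<circ> \<phi> = \<phi> \<circ> br \<xi> \<and>
     (\<forall>x y. \<eta> x = 0 \<longrightarrow> \<eta> y = 0 \<longrightarrow> br (\<phi> x) (\<phi> y) = br x y)"

text \<open>\<open>(i, j, k)\<close> is an even permutation of \<open>(1, 2, 3)\<close>.\<close>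

definition even_perm3 :: "nat \<Rightarrow> nat \<Rightarrow> nat \<Rightarrow> bool" where
  "even_perm3 i j k \<longleftrightarrow>
     (\<exists>p. p permutes {1,2,3} \<and> evenperm p \<and> i = p 1 \<and> j = p 2 \<and> k = p 3)"

text \<open>The condition \<open>dim UNIV = 4 * n + 3\<close> entails finite dimensionality, since \<open>dim\<close> is \<open>0\<close>
  on infinite-dimensional spaces.\<close>

definition almost_3_contact_lie_algebra ::
  "nat \<Rightarrow> ('a::real_vector \<Rightarrow> 'a \<Rightarrow> 'a) \<Rightarrow> (nat \<Rightarrow> 'a \<Rightarrow> 'a) \<Rightarrow> (nat \<Rightarrow> 'a) \<Rightarrow>
   (nat \<Rightarrow> 'a \<Rightarrow> real) \<Rightarrow> bool" where
  "almost_3_contact_lie_algebra n br \<phi> \<xi> \<eta> \<longleftrightarrow>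
     lie_algebra br \<and> n \<ge> 1 \<and> dim (UNIV :: 'a set) = 4 * n + 3 \<and>
     (\<forall>i\<in>{1,2,3}. almost_contact (\<phi> i) (\<xi> i) (\<eta> i)) \<and>
     (\<forall>i j k. even_perm3 i j k \<longrightarrow>
        (\<forall>x. \<phi> k x = \<phi> i (\<phi> j x) - \<eta> j x *\<^sub>R \<xi> i) \<and>
        (\<forall>x. \<phi> k x = - \<phi> j (\<phi> i x) + \<eta> i x *\<^sub>R \<xi> j) \<and>
        \<xi> k = \<phi> i (\<xi> j) \<and> \<xi> k = - \<phi> j (\<xi> i) \<and>
        (\<forall>x. \<eta> k x = \<eta> i (\<phi> j x)) \<and> (\<forall>x. \<eta> k x = - \<eta> j (\<phi> i x)))"

definition abelian_3_structure ::
  "('a::real_vector \<Rightarrow> 'a \<Rightarrow> 'a) \<Rightarrow> (nat \<Rightarrow> 'a \<Rightarrow> 'a) \<Rightarrow> (nat \<Rightarrow> 'a) \<Rightarrow>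
   (nat \<Rightarrow> 'a \<Rightarrow> real) \<Rightarrow> bool" where
  "abelian_3_structure br \<phi> \<xi> \<eta> \<longleftrightarrow>
     (\<forall>i\<in>{1,2,3}. abelian_almost_contact br (\<phi> i) (\<xi> i) (\<eta> i))"

definition horizontal :: "(nat \<Rightarrow> 'a::real_vector \<Rightarrow> real) \<Rightarrow> 'a set" where
  "horizontal \<eta> = (\<Inter>i\<in>{1,2,3}. {x. \<eta> i x = 0})"

definition vertical :: "(nat \<Rightarrow> 'a::real_vector) \<Rightarrow> 'a set" where
  "vertical \<xi> = span {\<xi> 1, \<xi> 2, \<xi> 3}"

text \<open>The endomorphism \<open>\<psi>\<close> of \<open>horizontal \<eta>\<close> is the restriction of the map below. The index
  \<open>1\<close> is an arbitrary choice, and the restriction is an endomorphism; see \<open>psi_eq\<close> and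
  \<open>psi_horizontal\<close>.\<close>

definition psi ::
  "('a::real_vector \<Rightarrow> 'a \<Rightarrow> 'a) \<Rightarrow> (nat \<Rightarrow> 'a \<Rightarrow> 'a) \<Rightarrow> (nat \<Rightarrow> 'a) \<Rightarrow> 'a \<Rightarrow> 'a" where
  "psi br \<phi> \<xi> x = br (\<xi> 1) (\<phi> 1 x)"

lemma even_perm3_cyclic: "even_perm3 1 2 3" "even_perm3 2 3 1" "even_perm3 3 1 2"
proof -
  show "even_perm3 1 2 3"
    unfolding even_perm3_def by (rule exI[of _ id]) simp
  have tr: "Transposition.transpose a b permutes {1,2,3::nat}"
    "permutation (Transposition.transpose a b)"
    if "a \<in> {1,2,3}" "b \<in> {1,2,3}" for a b :: nat
    using that by (auto intro: permutes_swap_id permutation_swap_id)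
  have ev: "evenperm (Transposition.transpose a b \<circ> Transposition.transpose c d)"
    if "a \<noteq> b" "c \<noteq> d" for a b c d :: nat
    using that by (simp add: evenperm_comp permutation_swap_id evenperm_swap)
  show "even_perm3 2 3 1"
    unfolding even_perm3_def
    by (rule exI[of _ "Transposition.transpose 1 2 \<circ> Transposition.transpose 2 (3::nat)"])
       (use permutes_compose[OF tr(1)[of 2 3] tr(1)[of 1 2]] ev[of 1 2 2 3] in
         \<open>simp add: Transposition.transpose_def\<close>)
  show "even_perm3 3 1 2"
    unfolding even_perm3_def
    by (rule exI[of _ "Transposition.transpose 1 3 \<circ> Transposition.transpose 2 (3::nat)"])
       (use permutes_compose[OF tr(1)[of 2 3] tr(1)[of 1 3]] ev[of 1 3 2 3] in
         \<open>simp add: Transposition.transpose_def\<close>)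
qed

lemma almost_contact_xi_eta:
  assumes "almost_contact \<phi> \<xi> \<eta>"
  shows "\<phi> \<xi> = 0" "\<eta> (\<phi> x) = 0"
proof -
  have lin: "linear \<phi>" "linear \<eta>" and sq: "\<And>x. \<phi> (\<phi> x) = - x + \<eta> x *\<^sub>R \<xi>" and one: "\<eta> \<xi> = 1"
    using assms by (auto simp: almost_contact_def)
  have eq: "\<eta> (\<phi> x) *\<^sub>R \<xi> = \<eta> x *\<^sub>R \<phi> \<xi>" for x
    using sq[of "\<phi> x"] arg_cong[OF sq[of x], of \<phi>] lin
    by (simp add: linear_add linear_neg linear_scale linear_diff)
  have "\<phi> \<xi> = \<eta> (\<phi> \<xi>) *\<^sub>R \<xi>" using eq[of \<xi>] one by simp
  moreover have "\<phi> (\<phi> \<xi>) = 0" using sq[of \<xi>] one by simp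
  ultimately have "\<eta> (\<phi> \<xi>) *\<^sub>R \<phi> \<xi> = 0" using lin by (metis linear_scale)
  then show *: "\<phi> \<xi> = 0" using \<open>\<phi> \<xi> = \<eta> (\<phi> \<xi>) *\<^sub>R \<xi>\<close> by auto
  have "\<xi> \<noteq> 0" using one lin by (metis linear_0 zero_neq_one)
  then show "\<eta> (\<phi> x) = 0" using eq[of x] * by simp
qed

lemma psi_step:
  assumes g: "almost_3_contact_lie_algebra n br \<phi> \<xi> \<eta>" "abelian_3_structure br \<phi> \<xi> \<eta>"
    and x: "x \<in> horizontal \<eta>" and e: "even_perm3 i j k" "even_perm3 j k i"
    and mem: "i \<in> {1,2,3}" "j \<in> {1,2,3}" "k \<in> {1,2,3}"
  shows "br (\<xi> j) (\<phi> j x) = br (\<xi> k) (\<phi> k x)"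
proof -
  have ac: "almost_contact (\<phi> j) (\<xi> j) (\<eta> j)" "almost_contact (\<phi> k) (\<xi> k) (\<eta> k)"
    and ab: "abelian_almost_contact br (\<phi> i) (\<xi> i) (\<eta> i)"
    using g mem unfolding almost_3_contact_lie_algebra_def abelian_3_structure_def by blast+
  have r: "\<And>x. \<phi> k x = \<phi> i (\<phi> j x) - \<eta> j x *\<^sub>R \<xi> i" "\<xi> k = \<phi> i (\<xi> j)"
    "\<And>x. \<eta> k x = \<eta> i (\<phi> j x)" "\<And>x. \<eta> i x = - \<eta> k (\<phi> j x)"
    using g(1) e unfolding almost_3_contact_lie_algebra_def by blast+
  have z: "\<eta> j x = 0" "\<eta> k x = 0" using x mem unfolding horizontal_def by blast+
  have "linear (\<eta> k)" using ac(2) by (auto simp: almost_contact_def)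
  then have "\<eta> i (\<xi> j) = 0"
    using r(4)[of "\<xi> j"] almost_contact_xi_eta(1)[OF ac(1)] by (simp add: linear_0)
  moreover have "\<eta> i (\<phi> j x) = 0" using r(3) z by simp
  ultimately have "br (\<phi> i (\<xi> j)) (\<phi> i (\<phi> j x)) = br (\<xi> j) (\<phi> j x)"
    using ab unfolding abelian_almost_contact_def by blast
  then show ?thesis using r(1,2) z by simp
qed

lemma psi_eq:
  assumes "almost_3_contact_lie_algebra n br \<phi> \<xi> \<eta>" "abelian_3_structure br \<phi> \<xi> \<eta>"
    and "x \<in> horizontal \<eta>" and i: "i \<in> {1,2,3}"
  shows "psi br \<phi> \<xi> x = br (\<xi> i) (\<phi> i x)" "psi br \<phi> \<xi> x = \<phi> i (br (\<xi> i) x)"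
proof -
  have "br (\<xi> 1) (\<phi> 1 x) = br (\<xi> 2) (\<phi> 2 x)"
    by (rule psi_step[OF assms(1-3) even_perm3_cyclic(3,1)]) simp_all
  moreover have "br (\<xi> 3) (\<phi> 3 x) = br (\<xi> 1) (\<phi> 1 x)"
    by (rule psi_step[OF assms(1-3) even_perm3_cyclic(2,3)]) simp_all
  ultimately show eq: "psi br \<phi> \<xi> x = br (\<xi> i) (\<phi> i x)"
    using i by (auto simp: psi_def)
  have "br (\<xi> i) \<circ> \<phi> i = \<phi> i \<circ> br (\<xi> i)"
    using assms(2) i unfolding abelian_3_structure_def abelian_almost_contact_def by blast
  then show "psi br \<phi> \<xi> x = \<phi> i (br (\<xi> i) x)"
    using eq by (simp add: fun_eq_iff)
qed

lemma psi_horizontal: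
  assumes "almost_3_contact_lie_algebra n br \<phi> \<xi> \<eta>" "abelian_3_structure br \<phi> \<xi> \<eta>"
    and "x \<in> horizontal \<eta>"
  shows "psi br \<phi> \<xi> x \<in> horizontal \<eta>"
proof -
  have "\<eta> i (psi br \<phi> \<xi> x) = 0" if i: "i \<in> {1,2,3}" for i
  proof -
    have "almost_contact (\<phi> i) (\<xi> i) (\<eta> i)"
      using assms(1) i unfolding almost_3_contact_lie_algebra_def by blast
    from almost_contact_xi_eta(2)[OF this] show ?thesis
      by (simp add: psi_eq(2)[OF assms i])
  qed
  then show ?thesis unfolding horizontal_def by blast
qed

end

theory Submission
  imports Defs
begin

text \<open>
  The \<open>\<phi> i\<close> act on the horizontal space as the unit quaternions and commute with \<open>\<psi>\<close>, and
  \<open>[\<xi> i, X] = - \<phi> i (\<psi> X)\<close> for horizontal \<open>X\<close>. Since the \<open>ad (\<xi> i)\<close> commute with \<open>\<phi> i\<close>, there are a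
  scalar \<open>c\<close> and a horizontal \<open>H\<close> with \<open>[\<xi> i, \<xi> j] = 2 c \<xi> k + \<phi> k H\<close>. The Jacobi identity for
  \<open>\<xi> 1, \<xi> 2, \<xi> 3\<close> reads \<open>3 \<psi> H = 0\<close>, so \<open>H = 0\<close>; the one for \<open>\<xi> i, \<xi> j, X\<close> then gives
  \<open>\<psi> (\<psi> X + c X) = 0\<close>, so \<open>\<psi> = - c\<close> and \<open>\<delta> = c\<close>. For horizontal \<open>X, Y\<close> the abelian condition makes
  \<open>[X, Y]\<close> commute with every \<open>\<xi> i\<close>, and only \<open>0\<close> does so. Finally \<open>\<xi> i \<mapsto> 2 \<delta> E i\<close>, with \<open>E i\<close> the
  matrix of the cross product with the \<open>i\<close>-th unit vector, identifies the vertical space with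
  \<open>so3\<close>, which acts on the horizontal one by \<open>\<rho> (E i) = \<phi> i / 2\<close>.
\<close>

section \<open>Even permutations of three indices\<close>

text \<open>By injectivity only six arrangements are possible; the three non-cyclic ones fix one
  index and swap the other two, hence come from a transposition, which is odd.\<close>

lemma even_perm3_iff:
  "even_perm3 i j k \<longleftrightarrow> (i, j, k) \<in> {(1, 2, 3), (2, 3, 1), (3, 1, 2)}"
proof
  assume "even_perm3 i j k"
  then obtain p where p: "p permutes {1,2,3::nat}" "evenperm p" "i = p 1" "j = p 2" "k = p 3"
    unfolding even_perm3_def by blast
  have mem: "i \<in> {1,2,3}" "j \<in> {1,2,3}" "k \<in> {1,2,3}"
    unfolding p permutes_in_image[OF p(1)] by simp_all
  have inj: "i \<noteq> j" "j \<noteq> k" "i \<noteq> k"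
    unfolding p by (simp_all add: inj_eq[OF permutes_inj[OF p(1)]])
  have fixed: "p x = x" if "x \<noteq> 1" "x \<noteq> 2" "x \<noteq> 3" for x
    using permutes_not_in[OF p(1), of x] that by blast
  have no_swap: False
    if "p a = b" "p b = a" "p c = c" "a \<noteq> b" "\<And>x. x \<noteq> a \<Longrightarrow> x \<noteq> b \<Longrightarrow> x \<noteq> c \<Longrightarrow> p x = x" for a b c
  proof -
    have "p = Transposition.transpose a b"
      using that by (intro ext) (metis Transposition.transpose_def)
    then show False using p(2) \<open>a \<noteq> b\<close> evenperm_swap[of a b] by simp
  qed
  have "(i, j, k) \<noteq> (1, 3, 2)"
  proof
    assume "(i, j, k) = (1, 3, 2)"
    then have "p 2 = 3" "p 3 = 2" "p 1 = 1" using p(3-5) by auto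
    then show False by (rule no_swap) (use fixed in auto)
  qed
  moreover have "(i, j, k) \<noteq> (3, 2, 1)"
  proof
    assume "(i, j, k) = (3, 2, 1)"
    then have "p 1 = 3" "p 3 = 1" "p 2 = 2" using p(3-5) by auto
    then show False by (rule no_swap) (use fixed in auto)
  qed
  moreover have "(i, j, k) \<noteq> (2, 1, 3)"
  proof
    assume "(i, j, k) = (2, 1, 3)"
    then have "p 1 = 2" "p 2 = 1" "p 3 = 3" using p(3-5) by auto
    then show False by (rule no_swap) (use fixed in auto)
  qed
  ultimately show "(i, j, k) \<in> {(1, 2, 3), (2, 3, 1), (3, 1, 2)}"
    using mem inj by auto
qed (use even_perm3_cyclic in auto)

lemma even_perm3_rotate: "even_perm3 i j k \<Longrightarrow> even_perm3 j k i"
  by (auto simp: even_perm3_iff)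

lemma even_perm3_mem:
  assumes "even_perm3 i j k"
  shows "i \<in> {1,2,3}" "j \<in> {1,2,3}" "k \<in> {1,2,3}"
  using assms by (auto simp: even_perm3_iff)

lemma even_perm3_exists: "i \<in> {1,2,3} \<Longrightarrow> \<exists>j k. even_perm3 i j k"
  by (auto simp: even_perm3_iff)


section \<open>Skew-symmetric matrices and the cross product\<close>

text \<open>The matrix of \<open>cross3 a\<close>; it identifies \<open>real^3\<close> under the
  cross product with \<open>so3\<close>.\<close>

definition hat :: "real^3 \<Rightarrow> real^3^3" where
  "hat a = vector [vector [0, - a$3, a$2], vector [a$3, 0, - a$1], vector [- a$2, a$1, 0]]"

text \<open>Reading off three entries is linear on all matrices; it inverts \<open>hat\<close>
  exactly on \<open>so3\<close>.\<close>

definition axial :: "real^3^3 \<Rightarrow> real^3" where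
  "axial A = vector [A$3$2, A$1$3, A$2$1]"

lemma axial_hat [simp]: "axial (hat a) = a"
  by (simp add: axial_def hat_def vec_eq_iff forall_3)

lemma hat_axial:
  assumes "A \<in> so3"
  shows "hat (axial A) = A"
proof -
  have skew: "A$j$i = - A$i$j" for i j
  proof -
    have "Finite_Cartesian_Product.transpose A $ i $ j = (- A) $ i $ j"
      using assms by (simp add: so3_def)
    then show ?thesis by (simp add: Finite_Cartesian_Product.transpose_def)
  qed
  have "A$1$1 = 0" "A$2$2 = 0" "A$3$3 = 0"
    using skew[of 1 1] skew[of 2 2] skew[of 3 3] by linarith+
  then show ?thesis
    using skew[of 1 2] skew[of 2 3] skew[of 3 1]
    by (simp add: axial_def hat_def vec_eq_iff forall_3)
qed

lemma hat_so3: "hat a \<in> so3"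
  by (simp add: hat_def so3_def vec_eq_iff forall_3 Finite_Cartesian_Product.transpose_def)

lemma linear_hat: "linear hat"
  by (rule linearI) (simp_all add: hat_def vec_eq_iff forall_3)

lemma linear_axial: "linear axial"
  by (rule linearI) (simp_all add: axial_def vec_eq_iff forall_3)

lemma commutator_hat: "commutator (hat a) (hat b) = hat (cross3 a b)"
  by (simp add: commutator_def hat_def cross3_def vec_eq_iff forall_3 matrix_matrix_mult_def sum_3
      algebra_simps)

lemma axial_commutator:
  "A \<in> so3 \<Longrightarrow> B \<in> so3 \<Longrightarrow> axial (commutator A B) = cross3 (axial A) (axial B)"
  by (metis axial_hat commutator_hat hat_axial)


section \<open>Structure of the bracket\<close>

locale abelian_3_contact =
  fixes n :: nat and br :: "'a::real_vector \<Rightarrow> 'a \<Rightarrow> 'a"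
    and \<phi> :: "nat \<Rightarrow> 'a \<Rightarrow> 'a" and \<xi> :: "nat \<Rightarrow> 'a" and \<eta> :: "nat \<Rightarrow> 'a \<Rightarrow> real"
  assumes almost: "almost_3_contact_lie_algebra n br \<phi> \<xi> \<eta>"
    and abelian: "abelian_3_structure br \<phi> \<xi> \<eta>"
begin

text \<open>Otherwise the simplifier turns the index \<open>1\<close> into \<open>Suc 0\<close>, and facts about \<open>\<phi> 1\<close> no longer match.\<close>

declare One_nat_def [simp del]

section \<open>Identities of the Lie bracket\<close>

lemma lie: "lie_algebra br"
  using almost by (simp add: almost_3_contact_lie_algebra_def)

lemma bilinear: "bilinear br"
  using lie by (simp add: lie_algebra_def)

lemmas br_simps = bilinear_ladd[OF bilinear] bilinear_radd[OF bilinear]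
  bilinear_lmul[OF bilinear] bilinear_rmul[OF bilinear]
  bilinear_lneg[OF bilinear] bilinear_rneg[OF bilinear]
  bilinear_lsub[OF bilinear] bilinear_rsub[OF bilinear]
  bilinear_lzero[OF bilinear] bilinear_rzero[OF bilinear]

lemma br_self [simp]: "br x x = 0"
  using lie by (simp add: lie_algebra_def)

lemma br_anti: "br y x = - br x y"
proof -
  have "br y x + br x y = 0"
    using br_self[of "x + y"] unfolding br_simps by (simp add: add.commute)
  then show ?thesis by (simp add: eq_neg_iff_add_eq_0)
qed

lemma jacobi: "br x (br y z) + br y (br z x) + br z (br x y) = 0"
  using lie by (simp add: lie_algebra_def)

text \<open>The Jacobi identity in the form ad [x, y] = [ad x, ad y], which also says that ad x is a
  derivation.\<close>

lemma br_br: "br (br x y) z = br x (br y z) - br y (br x z)"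
proof -
  have "br y (br z x) = - br y (br x z)"
    using br_anti[of z x] by (simp add: br_simps)
  then have "br x (br y z) - br y (br x z) = - br z (br x y)"
    using jacobi[of x y z] by (subst eq_neg_iff_add_eq_0) simp
  then show ?thesis
    using br_anti[of "br x y" z] by simp
qed

section \<open>Algebra of the three contact structures\<close>

lemma contact: "i \<in> {1,2,3} \<Longrightarrow> almost_contact (\<phi> i) (\<xi> i) (\<eta> i)"
  using almost unfolding almost_3_contact_lie_algebra_def by blast

lemma linear_phi: "i \<in> {1,2,3} \<Longrightarrow> linear (\<phi> i)"
  and linear_eta: "i \<in> {1,2,3} \<Longrightarrow> linear (\<eta> i)"
  and phi_phi: "i \<in> {1,2,3} \<Longrightarrow> \<phi> i (\<phi> i x) = - x + \<eta> i x *\<^sub>R \<xi> i"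
  and eta_xi: "i \<in> {1,2,3} \<Longrightarrow> \<eta> i (\<xi> i) = 1"
  using contact unfolding almost_contact_def by blast+

lemma phi_simps:
  assumes "i \<in> {1,2,3}"
  shows "\<phi> i (x + y) = \<phi> i x + \<phi> i y" "\<phi> i (c *\<^sub>R x) = c *\<^sub>R \<phi> i x"
    "\<phi> i (x - y) = \<phi> i x - \<phi> i y" "\<phi> i (- x) = - \<phi> i x" "\<phi> i 0 = 0"
  using linear_phi[OF assms]
  by (auto simp: linear_add linear_scale linear_diff linear_neg linear_0)

lemma eta_simps:
  assumes "i \<in> {1,2,3}"
  shows "\<eta> i (x + y) = \<eta> i x + \<eta> i y" "\<eta> i (c *\<^sub>R x) = c * \<eta> i x"
    "\<eta> i (x - y) = \<eta> i x - \<eta> i y" "\<eta> i (- x) = - \<eta> i x" "\<eta> i 0 = 0"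
  using linear_eta[OF assms]
  by (auto simp: linear_add linear_scale linear_diff linear_neg linear_0)

lemma phi_xi: "i \<in> {1,2,3} \<Longrightarrow> \<phi> i (\<xi> i) = 0"
  and eta_phi: "i \<in> {1,2,3} \<Longrightarrow> \<eta> i (\<phi> i x) = 0"
  using almost_contact_xi_eta[OF contact] by blast+

lemma relations:
  assumes "even_perm3 i j k"
  shows "\<phi> k x = \<phi> i (\<phi> j x) - \<eta> j x *\<^sub>R \<xi> i"
    "\<phi> k x = - \<phi> j (\<phi> i x) + \<eta> i x *\<^sub>R \<xi> j"
    "\<xi> k = \<phi> i (\<xi> j)" "\<xi> k = - \<phi> j (\<xi> i)"
    "\<eta> k x = \<eta> i (\<phi> j x)" "\<eta> k x = - \<eta> j (\<phi> i x)"
  using almost assms unfolding almost_3_contact_lie_algebra_def by blast+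

lemma phi_xi_cyclic:
  assumes e: "even_perm3 i j k"
  shows "\<phi> i (\<xi> j) = \<xi> k" "\<phi> j (\<xi> i) = - \<xi> k"
  using relations(3)[OF e] by simp (subst relations(4)[OF e], simp)

lemma eta_xi_cyclic:
  assumes e: "even_perm3 i j k"
  shows "\<eta> i (\<xi> j) = 0" "\<eta> j (\<xi> i) = 0"
proof -
  note e' = even_perm3_rotate[OF e] and m = even_perm3_mem[OF e]
  show "\<eta> i (\<xi> j) = 0"
    using relations(6)[OF e', of "\<xi> j"] m by (simp add: phi_xi eta_simps)
  show "\<eta> j (\<xi> i) = 0"
    using relations(5)[OF even_perm3_rotate[OF e'], of "\<xi> i"] m by (simp add: phi_xi eta_simps)
qed

lemma horizontal_iff: "x \<in> horizontal \<eta> \<longleftrightarrow> \<eta> 1 x = 0 \<and> \<eta> 2 x = 0 \<and> \<eta> 3 x = 0"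
  by (simp add: horizontal_def)

lemma eta_horizontal: "x \<in> horizontal \<eta> \<Longrightarrow> i \<in> {1,2,3} \<Longrightarrow> \<eta> i x = 0"
  by (auto simp: horizontal_def)

lemma subspace_horizontal: "subspace (horizontal \<eta>)"
  by (rule subspaceI) (auto simp: horizontal_iff eta_simps)

lemmas horizontal_closed =
  subspace_add[OF subspace_horizontal] subspace_diff[OF subspace_horizontal]
  subspace_neg[OF subspace_horizontal] subspace_scale[OF subspace_horizontal]
  subspace_0[OF subspace_horizontal]

text \<open>Composition with \<open>\<phi> i\<close> kills \<open>\<eta> i\<close> and exchanges the
  other two forms up to sign.\<close>

lemma phi_horizontal:
  assumes x: "x \<in> horizontal \<eta>" and i: "i \<in> {1,2,3}"
  shows "\<phi> i x \<in> horizontal \<eta>"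
proof -
  obtain j k where e: "even_perm3 i j k" using even_perm3_exists[OF i] by blast
  note m = even_perm3_mem[OF e]
  have "\<eta> i (\<phi> i x) = 0" using eta_phi[OF i] .
  moreover have "\<eta> j (\<phi> i x) = 0"
    using relations(6)[OF e, of x] eta_horizontal[OF x m(3)] by simp
  moreover have "\<eta> k (\<phi> i x) = 0"
    using relations(5)[OF even_perm3_rotate[OF even_perm3_rotate[OF e]], of x]
      eta_horizontal[OF x m(2)] by simp
  ultimately show ?thesis
    using e by (auto simp: horizontal_iff even_perm3_iff)
qed

lemma phi_phi_horizontal:
  "x \<in> horizontal \<eta> \<Longrightarrow> i \<in> {1,2,3} \<Longrightarrow> \<phi> i (\<phi> i x) = - x"
  using phi_phi eta_horizontal by simp

lemma phi_cyclic:
  assumes x: "x \<in> horizontal \<eta>" and e: "even_perm3 i j k"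
  shows "\<phi> i (\<phi> j x) = \<phi> k x" "\<phi> j (\<phi> i x) = - \<phi> k x"
proof -
  have z: "\<eta> i x = 0" "\<eta> j x = 0"
    using eta_horizontal[OF x] even_perm3_mem[OF e] by blast+
  show "\<phi> i (\<phi> j x) = \<phi> k x"
    using relations(1)[OF e, of x] z by simp
  show "\<phi> j (\<phi> i x) = - \<phi> k x"
    by (subst relations(2)[OF e]) (simp add: z)
qed

lemma br_xi_phi: "i \<in> {1,2,3} \<Longrightarrow> br (\<xi> i) (\<phi> i x) = \<phi> i (br (\<xi> i) x)"
  using abelian unfolding abelian_3_structure_def abelian_almost_contact_def
  by (meson comp_eq_dest)

lemma br_phi_phi:
  assumes "x \<in> horizontal \<eta>" "y \<in> horizontal \<eta>" "i \<in> {1,2,3}"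
  shows "br (\<phi> i x) (\<phi> i y) = br x y"
  using abelian assms eta_horizontal
  unfolding abelian_3_structure_def abelian_almost_contact_def by blast

section \<open>The endomorphism \<open>\<psi>\<close> and the adjoint action on the horizontal
  subspace\<close>

abbreviation \<psi> :: "'a \<Rightarrow> 'a" where "\<psi> \<equiv> psi br \<phi> \<xi>"

lemmas psi_in_horizontal = psi_horizontal[OF almost abelian]

lemma psi_simps:
  "\<psi> (x + y) = \<psi> x + \<psi> y" "\<psi> (c *\<^sub>R x) = c *\<^sub>R \<psi> x" "\<psi> (- x) = - \<psi> x" "\<psi> 0 = 0"
  "\<psi> (x - y) = \<psi> x - \<psi> y"
  by (simp_all add: psi_def phi_simps br_simps)

text \<open>Solves the equation \<open>\<psi> x = br (\<xi> i) (\<phi> i x)\<close> for the action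
  of \<open>\<xi> i\<close>, using that \<open>\<phi> i\<close> squares to -1 on horizontal vectors.
  A single \<open>\<psi>\<close> thus governs all three actions.\<close>

lemma br_xi_horizontal:
  assumes x: "x \<in> horizontal \<eta>" and i: "i \<in> {1,2,3}"
  shows "br (\<xi> i) x = - \<phi> i (\<psi> x)"
proof -
  have "- br (\<xi> i) x = \<phi> i (br (\<xi> i) (\<phi> i x))"
    using br_xi_phi[OF i, of "\<phi> i x"] phi_phi_horizontal[OF x i] by (simp add: br_simps)
  then have "br (\<xi> i) x = - \<phi> i (br (\<xi> i) (\<phi> i x))"
    by (metis minus_minus)
  then show ?thesis
    using psi_eq(1)[OF almost abelian x i] by simp
qed

text \<open>Since \<open>\<psi>\<close> may be computed with any index, index \<open>i\<close> is
  chosen, so that the square of \<open>\<phi> i\<close> appears.\<close>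

lemma psi_phi:
  assumes x: "x \<in> horizontal \<eta>" and i: "i \<in> {1,2,3}"
  shows "\<psi> (\<phi> i x) = \<phi> i (\<psi> x)"
proof -
  have "\<psi> (\<phi> i x) = br (\<xi> i) (\<phi> i (\<phi> i x))"
    using psi_eq(1)[OF almost abelian phi_horizontal[OF x i] i] .
  also have "\<dots> = - br (\<xi> i) x"
    using phi_phi_horizontal[OF x i] by (simp add: br_simps)
  finally show ?thesis
    using br_xi_horizontal[OF x i] by simp
qed

section \<open>Brackets of the vertical generators\<close>

definition hor :: "'a \<Rightarrow> 'a" where
  "hor x = x - (\<eta> 1 x *\<^sub>R \<xi> 1 + \<eta> 2 x *\<^sub>R \<xi> 2 + \<eta> 3 x *\<^sub>R \<xi> 3)"

lemmas eta_xi_numeral =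
  eta_xi_cyclic[OF even_perm3_cyclic(1)] eta_xi_cyclic[OF even_perm3_cyclic(2)]
  eta_xi_cyclic[OF even_perm3_cyclic(3)]

lemma hor_horizontal: "hor x \<in> horizontal \<eta>"
  by (simp add: horizontal_iff hor_def eta_simps eta_xi eta_xi_numeral)

text \<open>Up to sign, \<open>\<xi> j\<close> is \<open>\<phi> i (\<xi> k)\<close> and
  \<open>\<xi> i\<close> is \<open>\<phi> j (\<xi> k)\<close>. As ad \<open>\<xi> i\<close> commutes
  with \<open>\<phi> i\<close>, and likewise for \<open>j\<close>, the bracket lies in the images of
  both \<open>\<phi> i\<close> and \<open>\<phi> j\<close>, which \<open>\<eta> i\<close> and
  \<open>\<eta> j\<close> annihilate.\<close>

lemma eta_br_xi:
  assumes e: "even_perm3 i j k"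
  shows "\<eta> i (br (\<xi> i) (\<xi> j)) = 0" "\<eta> j (br (\<xi> i) (\<xi> j)) = 0"
proof -
  note e' = even_perm3_rotate[OF e] note e'' = even_perm3_rotate[OF e']
  note m = even_perm3_mem[OF e]
  have "- br (\<xi> i) (\<xi> j) = \<phi> i (br (\<xi> i) (\<xi> k))"
    using br_xi_phi[OF m(1), of "\<xi> k"] phi_xi_cyclic(2)[OF e''] by (simp add: br_simps)
  then have "\<eta> i (- br (\<xi> i) (\<xi> j)) = 0"
    using eta_phi[OF m(1)] by simp
  then show "\<eta> i (br (\<xi> i) (\<xi> j)) = 0"
    using m(1) by (simp add: eta_simps)
  have "- br (\<xi> i) (\<xi> j) = \<phi> j (br (\<xi> j) (\<xi> k))"
    using br_xi_phi[OF m(2), of "\<xi> k"] phi_xi_cyclic(1)[OF e'] br_anti[of "\<xi> j" "\<xi> i"]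
    by simp
  then have "\<eta> j (- br (\<xi> i) (\<xi> j)) = 0"
    using eta_phi[OF m(2)] by simp
  then show "\<eta> j (br (\<xi> i) (\<xi> j)) = 0"
    using m(2) by (simp add: eta_simps)
qed

text \<open>Applying \<open>\<phi> i\<close> to \<open>[\<xi> i, \<xi> j]\<close> gives
  \<open>[\<xi> i, \<xi> k]\<close>, so one bracket determines the next with the same
  \<open>c\<close> and \<open>H\<close>.\<close>

lemma br_xi_xi_step:
  assumes e: "even_perm3 i j k" and H: "H \<in> horizontal \<eta>"
    and br: "br (\<xi> i) (\<xi> j) = c *\<^sub>R \<xi> k + \<phi> k H"
  shows "br (\<xi> k) (\<xi> i) = c *\<^sub>R \<xi> j + \<phi> j H"
proof -
  note e' = even_perm3_rotate[OF e] note e'' = even_perm3_rotate[OF e']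
  note m = even_perm3_mem[OF e]
  have "br (\<xi> k) (\<xi> i) = - \<phi> i (br (\<xi> i) (\<xi> j))"
    using br_xi_phi[OF m(1), of "\<xi> j"] phi_xi_cyclic(1)[OF e] br_anti[of "\<xi> k" "\<xi> i"] by simp
  also have "\<dots> = c *\<^sub>R \<xi> j + \<phi> j H"
    unfolding br using phi_xi_cyclic(2)[OF e''] phi_cyclic(2)[OF H e''] m
    by (simp add: phi_simps)
  finally show ?thesis .
qed

lemma br_xi_xi:
  obtains c H where "H \<in> horizontal \<eta>"
    and "\<And>i j k. even_perm3 i j k \<Longrightarrow> br (\<xi> i) (\<xi> j) = (2 * c) *\<^sub>R \<xi> k + \<phi> k H"
proof -
  \<comment> \<open>The vertical part of the bracket is a multiple of \<open>\<xi> 3\<close> by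
    \<open>eta_br_xi\<close>; the halving makes \<open>c\<close> itself the final constant.
    \<open>H\<close> is chosen so that \<open>\<phi> 3 H\<close> is the horizontal part.\<close>
  define c where "c = \<eta> 3 (br (\<xi> 1) (\<xi> 2)) / 2"
  define H where "H = - \<phi> 3 (hor (br (\<xi> 1) (\<xi> 2)))"
  have H: "H \<in> horizontal \<eta>"
    unfolding H_def by (intro horizontal_closed phi_horizontal hor_horizontal) auto
  have 1: "br (\<xi> 1) (\<xi> 2) = (2 * c) *\<^sub>R \<xi> 3 + \<phi> 3 H"
    using phi_phi_horizontal[OF hor_horizontal, of 3 "br (\<xi> 1) (\<xi> 2)"]
      eta_br_xi[OF even_perm3_cyclic(1)]
    by (simp add: H_def c_def phi_simps) (simp add: hor_def)
  note 2 = br_xi_xi_step[OF even_perm3_cyclic(1) H 1]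
  note 3 = br_xi_xi_step[OF even_perm3_cyclic(3) H 2]
  show thesis
    by (rule that[OF H, of c]) (use 1 2 3 in \<open>auto simp: even_perm3_iff\<close>)
qed

section \<open>Determination of \<open>\<psi>\<close> and of the structure constant\<close>

lemma hor_id: "x \<in> horizontal \<eta> \<Longrightarrow> hor x = x"
  by (simp add: hor_def horizontal_iff)

lemma dim_UNIV: "dim (UNIV :: 'a set) = 4 * n + 3" and n_pos: "n \<ge> 1"
  using almost by (simp_all add: almost_3_contact_lie_algebra_def)

text \<open>Otherwise three vectors would span a space of dimension at least 7. A nonzero horizontal
  vector is what later forces the structure constant to be nonzero.\<close>

lemma horizontal_nontrivial: "\<exists>x \<in> horizontal \<eta>. x \<noteq> 0"
proof (rule ccontr)
  assume "\<not> ?thesis"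
  then have "hor x = 0" for x using hor_horizontal by blast
  then have "x = \<eta> 1 x *\<^sub>R \<xi> 1 + \<eta> 2 x *\<^sub>R \<xi> 2 + \<eta> 3 x *\<^sub>R \<xi> 3" for x
    by (metis hor_def eq_iff_diff_eq_0)
  moreover have "\<eta> 1 x *\<^sub>R \<xi> 1 + \<eta> 2 x *\<^sub>R \<xi> 2 + \<eta> 3 x *\<^sub>R \<xi> 3 \<in> span {\<xi> 1, \<xi> 2, \<xi> 3}" for x
    by (intro span_add span_scale span_base) simp_all
  ultimately have "x \<in> span {\<xi> 1, \<xi> 2, \<xi> 3}" for x
    by metis
  then have "(UNIV :: 'a set) \<subseteq> span {\<xi> 1, \<xi> 2, \<xi> 3}" by blast
  then have "dim (UNIV :: 'a set) \<le> card {\<xi> 1, \<xi> 2, \<xi> 3}"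
    by (rule dim_le_card) simp
  also have "\<dots> \<le> 3"
    by (simp add: card_insert_if)
  finally show False using dim_UNIV n_pos by simp
qed

text \<open>The Jacobi identity for \<open>\<xi> 1, \<xi> 2, \<phi> 3 X\<close>: for invertible \<open>\<psi>\<close> it turns the vanishing
  of \<open>H\<close> into \<open>\<psi> = - c\<close>.\<close>

lemma br_horizontal_obstruction:
  assumes H: "H \<in> horizontal \<eta>" and X: "X \<in> horizontal \<eta>"
    and br: "\<And>i j k. even_perm3 i j k \<Longrightarrow> br (\<xi> i) (\<xi> j) = (2 * c) *\<^sub>R \<xi> k + \<phi> k H"
  shows "br H X = - 2 *\<^sub>R (\<psi> (\<psi> X) + c *\<^sub>R \<psi> X)"
proof -
  note e = even_perm3_cyclic(1) note m = even_perm3_mem[OF e]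
  define Y where "Y = - \<phi> 3 X"
  have Y: "Y \<in> horizontal \<eta>" and X_eq: "\<phi> 3 Y = X"
    unfolding Y_def using X
    by (auto intro!: horizontal_closed phi_horizontal simp: phi_phi_horizontal phi_simps)
  note hs = psi_in_horizontal phi_horizontal horizontal_closed Y
  \<comment> \<open>Each action contributes a factor \<open>- \<phi> \<psi>\<close>; the signs
    cancel and \<open>\<psi>\<close> commutes past \<open>\<phi>\<close>.\<close>
  have s: "br (\<xi> i) (br (\<xi> j) Y) = \<phi> i (\<phi> j (\<psi> (\<psi> Y)))"
    if "i \<in> {1,2,3}" "j \<in> {1,2,3}" for i j
    using that by (simp add: br_xi_horizontal psi_phi psi_simps phi_simps hs)
  have "br (br (\<xi> 1) (\<xi> 2)) Y = 2 *\<^sub>R \<phi> 3 (\<psi> (\<psi> Y))"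
    unfolding br_br using s[OF m(1,2)] s[OF m(2,1)] phi_cyclic[OF _ e, of "\<psi> (\<psi> Y)"]
    by (simp add: hs scaleR_2)
  then have "br (\<phi> 3 H) Y = 2 *\<^sub>R \<phi> 3 (\<psi> (\<psi> Y)) + (2 * c) *\<^sub>R \<phi> 3 (\<psi> Y)"
    unfolding br[OF e] using br_xi_horizontal[OF Y m(3)]
    by (simp add: br_simps algebra_simps)
  also have "\<dots> = 2 *\<^sub>R (\<psi> (\<psi> X) + c *\<^sub>R \<psi> X)"
    unfolding X_eq[symmetric] using m(3) by (simp add: psi_phi hs algebra_simps)
  finally have 1: "br (\<phi> 3 H) Y = 2 *\<^sub>R (\<psi> (\<psi> X) + c *\<^sub>R \<psi> X)" .
  \<comment> \<open>A second evaluation of the same bracket, now by the abelian condition for index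
    3.\<close>
  have "br (\<phi> 3 H) Y = br (\<phi> 3 (\<phi> 3 H)) (\<phi> 3 Y)"
    using br_phi_phi[OF phi_horizontal[OF H m(3)] Y m(3)] by simp
  also have "\<dots> = - br H X"
    using phi_phi_horizontal[OF H m(3)] by (simp add: X_eq br_simps)
  finally show ?thesis using 1 by (simp add: minus_equation_iff[of "br H X"])
qed

lemma structure_constant:
  assumes bij: "bij_betw \<psi> (horizontal \<eta>) (horizontal \<eta>)"
  obtains c :: real where "c \<noteq> 0"
    and "\<And>i j k. even_perm3 i j k \<Longrightarrow> br (\<xi> i) (\<xi> j) = (2 * c) *\<^sub>R \<xi> k"
    and "\<And>i x. i \<in> {1,2,3} \<Longrightarrow> x \<in> horizontal \<eta> \<Longrightarrow> br (\<xi> i) x = c *\<^sub>R \<phi> i x"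
proof -
  obtain c H where H: "H \<in> horizontal \<eta>"
    and br: "\<And>i j k. even_perm3 i j k \<Longrightarrow> br (\<xi> i) (\<xi> j) = (2 * c) *\<^sub>R \<xi> k + \<phi> k H"
    by (rule br_xi_xi) (rule that; blast)
  have psi_0: "x = 0" if "x \<in> horizontal \<eta>" "\<psi> x = 0" for x
    using inj_onD[OF bij_betw_imp_inj_on[OF bij], of x 0] that by (simp add: psi_simps horizontal_closed)
  \<comment> \<open>The inner bracket is \<open>(2 * c) *\<^sub>R \<xi> i + \<phi> i H\<close>; its
    first term commutes with \<open>\<xi> i\<close>, and its second yields
    \<open>\<psi> H\<close>.\<close>
  have step: "br (\<xi> i) (br (\<xi> j) (\<xi> k)) = \<psi> H" if e: "even_perm3 i j k" for i j k
    using br[OF even_perm3_rotate[OF e]] br_xi_phi even_perm3_mem[OF e]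
      psi_eq(2)[OF almost abelian H] by (simp add: br_simps)
  have "\<psi> H + \<psi> H + \<psi> H = 0"
    using jacobi[of "\<xi> 1" "\<xi> 2" "\<xi> 3"]
    by (simp add: step[OF even_perm3_cyclic(1)] step[OF even_perm3_cyclic(2)]
        step[OF even_perm3_cyclic(3)])
  then have "(1 + 1 + 1 :: real) *\<^sub>R \<psi> H = 0"
    by (simp only: scaleR_add_left scaleR_one)
  then have H0: "H = 0"
    using psi_0[OF H] by simp
  have psi: "\<psi> x = - c *\<^sub>R x" if x: "x \<in> horizontal \<eta>" for x
  proof -
    have "\<psi> (\<psi> x) + c *\<^sub>R \<psi> x = 0"
      using br_horizontal_obstruction[OF H x br] unfolding H0 by (simp add: br_simps)
    then have "\<psi> (\<psi> x + c *\<^sub>R x) = 0" by (simp add: psi_simps)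
    then have "\<psi> x + c *\<^sub>R x = 0"
      by (rule psi_0[rotated]) (intro horizontal_closed psi_in_horizontal x)
    then show ?thesis by (simp add: eq_neg_iff_add_eq_0)
  qed
  show thesis
  proof
    obtain x where x: "x \<in> horizontal \<eta>" "x \<noteq> 0" using horizontal_nontrivial by blast
    \<comment> \<open>For \<open>c = 0\<close> the injective \<open>\<psi>\<close> would vanish on
      the nonzero vector \<open>x\<close>.\<close>
    show "c \<noteq> 0" using psi_0[OF x(1)] psi[OF x(1)] x(2) by auto
    show "br (\<xi> i) (\<xi> j) = (2 * c) *\<^sub>R \<xi> k" if "even_perm3 i j k" for i j k
      using br[OF that] even_perm3_mem[OF that] by (simp add: H0 phi_simps)
    show "br (\<xi> i) x = c *\<^sub>R \<phi> i x" if "i \<in> {1,2,3}" "x \<in> horizontal \<eta>" for i x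
      using br_xi_horizontal[OF that(2,1)] psi[OF that(2)] that(1) by (simp add: phi_simps)
  qed
qed

section \<open>Quaternionic coordinates\<close>

text \<open>\<open>real^3\<close> plays the role of the imaginary quaternions: \<open>V\<close> embeds it as the vertical
  subspace and \<open>Q\<close> is its action on the horizontal one.\<close>

definition V :: "real^3 \<Rightarrow> 'a" where
  "V a = a$1 *\<^sub>R \<xi> 1 + a$2 *\<^sub>R \<xi> 2 + a$3 *\<^sub>R \<xi> 3"

definition Q :: "real^3 \<Rightarrow> 'a \<Rightarrow> 'a" where
  "Q a x = a$1 *\<^sub>R \<phi> 1 x + a$2 *\<^sub>R \<phi> 2 x + a$3 *\<^sub>R \<phi> 3 x"

definition ev :: "'a \<Rightarrow> real^3" where
  "ev x = vector [\<eta> 1 x, \<eta> 2 x, \<eta> 3 x]"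

lemma V_ev_hor: "V (ev x) + hor x = x"
  by (simp add: V_def ev_def hor_def)

lemma linear_V: "linear V"
  by (rule linearI) (simp_all add: V_def algebra_simps)

lemma linear_ev: "linear ev"
  by (rule linearI) (simp_all add: ev_def vec_eq_iff forall_3 eta_simps)

lemma ev_V [simp]: "ev (V a) = a"
  by (simp add: ev_def V_def vec_eq_iff forall_3 eta_simps eta_xi eta_xi_numeral)

lemma ev_horizontal: "x \<in> horizontal \<eta> \<Longrightarrow> ev x = 0"
  by (simp add: ev_def horizontal_iff vec_eq_iff forall_3)

lemma hor_V [simp]: "hor (V a) = 0"
  using V_ev_hor[of "V a"] by simp

lemma linear_hor: "linear hor"
  by (rule linearI) (simp_all add: hor_def eta_simps algebra_simps)

lemma linear_Q: "linear (Q a)"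
  by (rule linearI) (simp_all add: Q_def phi_simps algebra_simps)

lemma Q_left:
  "Q (a + b) x = Q a x + Q b x" "Q (r *\<^sub>R a) x = r *\<^sub>R Q a x" "Q 0 x = 0"
  by (simp_all add: Q_def algebra_simps)

lemma Q_horizontal: "x \<in> horizontal \<eta> \<Longrightarrow> Q a x \<in> horizontal \<eta>"
  unfolding Q_def by (intro horizontal_closed phi_horizontal) simp_all

text \<open>The quaternion rule ab - ba = 2 (a x b) for imaginary a and b.\<close>

lemma Q_commutator:
  assumes x: "x \<in> horizontal \<eta>"
  shows "Q a (Q b x) - Q b (Q a x) = 2 *\<^sub>R Q (cross3 a b) x"
proof -
  note c = phi_cyclic[OF x even_perm3_cyclic(1)] phi_cyclic[OF x even_perm3_cyclic(2)]
    phi_cyclic[OF x even_perm3_cyclic(3)]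
  show ?thesis
    unfolding scaleR_2
    by (simp add: Q_def phi_simps c phi_phi_horizontal[OF x] cross3_def algebra_simps)
qed

lemma vertical_eq: "vertical \<xi> = range V"
proof
  have "\<xi> 1 = V (vector [1, 0, 0])" "\<xi> 2 = V (vector [0, 1, 0])" "\<xi> 3 = V (vector [0, 0, 1])"
    by (simp_all add: V_def)
  then have "{\<xi> 1, \<xi> 2, \<xi> 3} \<subseteq> range V" by blast
  then show "vertical \<xi> \<subseteq> range V"
    unfolding vertical_def
    by (rule span_minimal) (rule linear_subspace_image[OF linear_V subspace_UNIV])
  show "range V \<subseteq> vertical \<xi>"
    unfolding vertical_def V_def
    by (intro image_subsetI span_add span_scale span_base) simp_all
qed

text \<open>Provides a linear isomorphism \<open>k\<close> from \<open>real^'m\<close> onto the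
  horizontal subspace, with inverse extended by zero to the vertical one. A horizontal basis
  together with the three \<open>\<xi> i\<close> is a basis of the whole space, so it has 4 n + 3
  elements, 4 n of them horizontal.\<close>

lemma horizontal_coordinates:
  assumes card: "CARD('m::finite) = 4 * n"
  obtains g :: "'a \<Rightarrow> real^'m" and k :: "real^'m \<Rightarrow> 'a"
  where "linear g" "linear k" "\<And>v. g (k v) = v" "\<And>v. k v \<in> horizontal \<eta>"
    and "\<And>x. k (g x) = hor x"
proof -
  obtain B where B: "B \<subseteq> horizontal \<eta>" "independent B" "horizontal \<eta> \<subseteq> span B"
    using basis_exists[of "horizontal \<eta>"] by metis
  have span_B: "span B = horizontal \<eta>"
    using B span_minimal[OF B(1) subspace_horizontal] by blast
  have ker: "subspace {x. \<eta> i x = 0}" if "i \<in> {1,2,3}" for i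
    using linear_eta[OF that] by (rule linear_subspace_kernel)
  have sub: "span S \<subseteq> {x. \<eta> i x = 0}" if "S \<subseteq> {x. \<eta> i x = 0}" "i \<in> {1,2,3}" for S i
    using span_minimal[OF that(1) ker[OF that(2)]] .
  have ker_B: "B \<subseteq> {x. \<eta> i x = 0}" if "i \<in> {1,2,3}" for i
    using B(1) eta_horizontal that by blast
  \<comment> \<open>Each \<open>\<xi> i\<close> is separated from the preceding span by
    \<open>\<eta> i\<close>, which vanishes on \<open>B\<close> and on the other generators.\<close>
  have notin: "\<xi> 1 \<notin> span B" "\<xi> 2 \<notin> span (insert (\<xi> 1) B)"
    "\<xi> 3 \<notin> span (insert (\<xi> 2) (insert (\<xi> 1) B))"
    using sub[OF ker_B[of 1]] sub[of "insert (\<xi> 1) B" 2] ker_B[of 2]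
      sub[of "insert (\<xi> 2) (insert (\<xi> 1) B)" 3] ker_B[of 3]
      eta_xi[of 1] eta_xi[of 2] eta_xi[of 3] eta_xi_numeral
    by auto
  define B' where "B' = insert (\<xi> 3) (insert (\<xi> 2) (insert (\<xi> 1) B))"
  have indep: "independent B'"
    unfolding B'_def using B(2) notin by (simp add: independent_insert)
  have "x \<in> span B'" for x
  proof -
    have "hor x \<in> span B'"
      using hor_horizontal span_mono[of B B'] unfolding span_B B'_def by blast
    moreover have "V (ev x) \<in> span B'"
      unfolding V_def B'_def by (intro span_add span_scale span_base) simp_all
    ultimately show ?thesis
      using span_add V_ev_hor by metis
  qed
  then have "span B' = UNIV" by blast
  then have card_B': "card B' = 4 * n + 3"
    using dim_eq_card[of B' UNIV] indep dim_UNIV by simp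
  then have "finite B'" by (metis card.infinite add_is_0 zero_neq_numeral)
  then have fin: "finite B" by (simp add: B'_def)
  have not_span: "x \<notin> span S \<Longrightarrow> x \<notin> S" for x :: 'a and S
    by (metis span_base)
  have "card B = 4 * n"
    using card_B' notin[THEN not_span] fin by (simp add: B'_def)
  then obtain \<beta> where \<beta>: "bij_betw \<beta> B (UNIV :: 'm set)"
    using finite_same_card_bij[of B "UNIV :: 'm set"] fin card by auto
  \<comment> \<open>The values of \<open>g0\<close> off the span of \<open>B\<close> are not
    controlled; composing with \<open>hor\<close> below makes it vanish on vertical vectors.\<close>
  obtain g0 :: "'a \<Rightarrow> real^'m" where g0: "linear g0" "\<And>b. b \<in> B \<Longrightarrow> g0 b = axis (\<beta> b) 1"
    using linear_independent_extend[OF B(2), of "\<lambda>b. axis (\<beta> b) 1"] by blast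
  define \<gamma> where "\<gamma> = inv_into B \<beta>"
  have \<gamma>: "\<gamma> i \<in> B" "\<beta> (\<gamma> i) = i" "b \<in> B \<Longrightarrow> \<gamma> (\<beta> b) = b" for i b
    using \<beta> unfolding \<gamma>_def
    by (auto simp: bij_betw_def inv_into_into f_inv_into_f)
  define k :: "real^'m \<Rightarrow> 'a" where "k v = (\<Sum>i\<in>UNIV. v$i *\<^sub>R \<gamma> i)" for v
  have lin_k: "linear k"
    by (rule linearI) (simp_all add: k_def scaleR_add_left sum.distrib scaleR_sum_right)
  have k_h: "k v \<in> horizontal \<eta>" for v
    unfolding k_def using \<gamma>(1) B(1)
    by (intro subspace_sum[OF subspace_horizontal] horizontal_closed) blast
  have k_axis: "k (axis i 1) = \<gamma> i" for i
    by (simp add: k_def axis_def if_distrib[of "\<lambda>r. r *\<^sub>R _"] cong: if_cong)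
  have g0_k: "g0 (k v) = v" for v
    unfolding k_def linear_sum[OF g0(1)] linear_scale[OF g0(1)]
    using basis_expansion[of v] by (simp add: g0(2) \<gamma>(1,2) scalar_mult_eq_scaleR)
  have "(k \<circ> g0) x = id x" if "x \<in> span B" for x
    using that
    by (rule linear_eq_on_span[OF linear_compose[OF g0(1) lin_k] linear_id, rotated])
      (simp add: g0(2) k_axis \<gamma>(3))
  then have k_g0: "k (g0 x) = x" if "x \<in> horizontal \<eta>" for x
    using that unfolding span_B by simp
  show thesis
  proof
    show "linear (g0 \<circ> hor)" by (rule linear_compose[OF linear_hor g0(1)])
    show "linear k" by (rule lin_k)
    show "(g0 \<circ> hor) (k v) = v" for v by (simp add: hor_id k_h g0_k)
    show "k v \<in> horizontal \<eta>" for v by (rule k_h)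
    show "k ((g0 \<circ> hor) x) = hor x" for x by (simp add: k_g0 hor_horizontal)
  qed
qed

end


section \<open>The semidirect product\<close>

text \<open>Fixes the constant found in \<open>structure_constant\<close>; \<open>c\<close> is the
  \<delta> of the theorem.\<close>

locale so3_contact = abelian_3_contact +
  fixes c :: real
  assumes c_nonzero: "c \<noteq> 0"
    and br_xi_cyclic: "even_perm3 i j k \<Longrightarrow> br (\<xi> i) (\<xi> j) = (2 * c) *\<^sub>R \<xi> k"
    and br_xi_h: "i \<in> {1,2,3} \<Longrightarrow> x \<in> horizontal \<eta> \<Longrightarrow> br (\<xi> i) x = c *\<^sub>R \<phi> i x"
begin

declare One_nat_def [simp del]

section \<open>The complete bracket\<close>

lemma br_V_V: "br (V a) (V b) = (2 * c) *\<^sub>R V (cross3 a b)"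
proof -
  have s: "br (\<xi> j) (\<xi> i) = - (2 * c) *\<^sub>R \<xi> k" if "even_perm3 i j k" for i j k
    using br_xi_cyclic[OF that] br_anti[of "\<xi> j" "\<xi> i"] by simp
  note e = even_perm3_cyclic
  show ?thesis
    by (simp add: V_def br_simps br_xi_cyclic[OF e(1)] br_xi_cyclic[OF e(2)] br_xi_cyclic[OF e(3)]
        s[OF e(1)] s[OF e(2)] s[OF e(3)] cross3_def algebra_simps)
qed

lemma br_V_horizontal: "x \<in> horizontal \<eta> \<Longrightarrow> br (V a) x = c *\<^sub>R Q a x"
  by (simp add: V_def Q_def br_simps br_xi_h algebra_simps)

text \<open>The vertical part of \<open>Z\<close> has zero cross product with everything, so it
  vanishes; then \<open>\<phi> 1 Z = 0\<close>, and \<open>\<phi> 1\<close> is invertible on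
  horizontal vectors.\<close>

lemma centralizer_vertical:
  assumes Z: "\<And>a. br (V a) Z = 0"
  shows "Z = 0"
proof -
  have eq: "(2 * c) *\<^sub>R V (cross3 a (ev Z)) + c *\<^sub>R Q a (hor Z) = 0" for a
    using Z[of a] br_V_V[of a "ev Z"] br_V_horizontal[OF hor_horizontal, of a Z]
    by (metis V_ev_hor br_simps(2))
  have h: "ev (Q a (hor Z)) = 0" for a
    by (simp add: ev_horizontal Q_horizontal hor_horizontal)
  have "ev ((2 * c) *\<^sub>R V (cross3 a (ev Z)) + c *\<^sub>R Q a (hor Z)) = 0" for a
    unfolding eq using linear_0[OF linear_ev] .
  then have "cross3 a (ev Z) = 0" for a
    using c_nonzero h by (simp add: linear_add[OF linear_ev] linear_scale[OF linear_ev])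
  \<comment> \<open>Two directions suffice: a vector parallel to both of the first two unit vectors
    is zero.\<close>
  from this[of "vector [1, 0, 0]"] this[of "vector [0, 1, 0]"]
  have ev: "ev Z = 0"
    by (simp add: cross3_def vec_eq_iff forall_3)
  then have hZ: "hor Z = Z" using V_ev_hor[of Z] by (simp add: linear_0[OF linear_V])
  then have Zh: "Z \<in> horizontal \<eta>" using hor_horizontal by metis
  have "Q (vector [1, 0, 0]) Z = 0"
    using eq[of "vector [1, 0, 0]"] ev hZ c_nonzero by (simp add: linear_0[OF linear_V])
  then have "\<phi> 1 Z = 0" by (simp add: Q_def)
  then show ?thesis
    using phi_phi_horizontal[OF Zh, of 1] by (simp add: phi_simps)
qed

text \<open>By the abelian condition \<open>\<phi> i\<close> is skew for the bracket on horizontal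
  vectors. As ad \<open>\<xi> i\<close> is a derivation acting there as \<open>c\<close> times
  \<open>\<phi> i\<close>, it kills \<open>[X, Y]\<close>.\<close>

lemma br_horizontal:
  assumes X: "X \<in> horizontal \<eta>" and Y: "Y \<in> horizontal \<eta>"
  shows "br X Y = 0"
proof (rule centralizer_vertical)
  have "br (\<xi> i) (br X Y) = 0" if i: "i \<in> {1,2,3}" for i
  proof -
    have "br X (\<phi> i Y) = - br (\<phi> i X) Y"
      using br_phi_phi[OF X phi_horizontal[OF Y i] i] phi_phi_horizontal[OF Y i]
      by (simp add: br_simps)
    then have "br (br (\<xi> i) X) Y + br X (br (\<xi> i) Y) = 0"
      by (simp add: br_xi_h X Y i[simplified] br_simps)
    then show ?thesis by (simp add: br_br)
  qed
  then show "br (V a) (br X Y) = 0" for a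
    by (simp add: V_def br_simps)
qed

lemma br_eq:
  "br x y = (2 * c) *\<^sub>R V (cross3 (ev x) (ev y)) + c *\<^sub>R (Q (ev x) (hor y) - Q (ev y) (hor x))"
proof -
  have "br x y = br (V (ev x) + hor x) (V (ev y) + hor y)"
    by (simp add: V_ev_hor)
  also have "\<dots> = br (V (ev x)) (V (ev y)) + br (V (ev x)) (hor y) - br (V (ev y)) (hor x)
      + br (hor x) (hor y)"
    using br_anti[of "hor x" "V (ev y)"] by (simp add: br_simps)
  finally show ?thesis
    by (simp add: br_V_V br_V_horizontal br_horizontal hor_horizontal algebra_simps)
qed

lemma vertical_subalgebra: "lie_subalgebra br (vertical \<xi>)"
  unfolding lie_subalgebra_def vertical_eq
  using linear_subspace_image[OF linear_V subspace_UNIV]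
  by (auto simp: br_V_V simp flip: linear_scale[OF linear_V])

lemma horizontal_ideal: "lie_ideal br (horizontal \<eta>)"
  unfolding lie_ideal_def
  by (simp add: subspace_horizontal br_eq ev_horizontal hor_id linear_0[OF linear_V] Q_left
      horizontal_closed Q_horizontal)

lemma horizontal_abelian: "abelian_on br (horizontal \<eta>)"
  unfolding abelian_on_def using br_horizontal by blast

section \<open>The vertical subalgebra as \<open>so3\<close>\<close>

text \<open>The scaling absorbs the factor in \<open>br_V_V\<close>, making the map multiplicative.
  It is defined on the whole algebra, with the horizontal ideal as kernel.\<close>

definition \<theta> :: "'a \<Rightarrow> real^3^3" where
  "\<theta> x = hat ((2 * c) *\<^sub>R ev x)"

lemma linear_theta: "linear \<theta>"
  using linear_compose[OF linear_compose[OF linear_ev linear_scale_self[of "2 * c"]] linear_hat]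
  by (simp add: \<theta>_def[abs_def] o_def)

lemma theta_br: "\<theta> (br x y) = commutator (\<theta> x) (\<theta> y)"
proof -
  have "ev (br x y) = (2 * c) *\<^sub>R cross3 (ev x) (ev y)"
    by (simp add: br_eq linear_add[OF linear_ev] linear_diff[OF linear_ev]
        linear_scale[OF linear_ev] ev_horizontal Q_horizontal hor_horizontal)
  then show ?thesis
    by (simp add: \<theta>_def commutator_hat cross_mult_left cross_mult_right)
qed

lemma theta_iso: "lie_iso (vertical \<xi>) br so3 commutator \<theta>"
proof -
  have "bij_betw \<theta> (range V) so3"
    by (rule bij_betwI[where g = "\<lambda>A. V (inverse (2 * c) *\<^sub>R axial A)"])
      (use c_nonzero in \<open>auto simp: \<theta>_def hat_so3 hat_axial\<close>)
  then show ?thesis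
    by (simp add: lie_iso_def lie_hom_def vertical_eq theta_br linear_add[OF linear_theta]
        linear_scale[OF linear_theta]) (simp add: \<theta>_def hat_so3)
qed

section \<open>The representation and the semidirect product\<close>

text \<open>The choice of \<open>\<rho>\<close> is dictated by the adjoint action:
  \<open>\<theta> (\<xi> i)\<close> must act as \<open>c\<close> times \<open>\<phi> i\<close>,
  transported to \<open>real^'m\<close> by \<open>k\<close> and \<open>g\<close>.\<close>

lemma semidirect_iso:
  assumes card: "CARD('m::finite) = 4 * n"
  shows "\<exists>(\<rho> :: real^3^3 \<Rightarrow> real^'m^'m) (f :: 'a \<Rightarrow> (real^3^3) \<times> (real^'m)).
    so3_representation \<rho> \<and>
    hypercomplex_structure (\<lambda>i v. inverse c *\<^sub>R (\<rho> (\<theta> (\<xi> i)) *v v)) \<and>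
    lie_iso UNIV br (so3 \<times> UNIV) (semidirect_bracket \<rho>) f \<and>
    (\<forall>x\<in>vertical \<xi>. f x = (\<theta> x, 0)) \<and>
    f ` horizontal \<eta> = {0} \<times> UNIV"
proof -
  obtain g :: "'a \<Rightarrow> real^'m" and k :: "real^'m \<Rightarrow> 'a"
    where g: "linear g" and k: "linear k" and gk: "\<And>v. g (k v) = v"
      and k_h: "\<And>v. k v \<in> horizontal \<eta>" and kg: "\<And>x. k (g x) = hor x"
    using horizontal_coordinates[OF card] by metis
  note lg = linear_add[OF g] linear_diff[OF g] linear_scale[OF g] linear_0[OF g] linear_neg[OF g]
  note lk = linear_add[OF k] linear_diff[OF k] linear_scale[OF k] linear_0[OF k] linear_neg[OF k]
  have g_V: "g (V a) = 0" for a
    using gk[of "g (V a)"] by (simp add: kg lg)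
  have g_hor: "g (hor x) = g x" for x
    using gk[of "g x"] by (simp add: kg)
  \<comment> \<open>The half compensates for the doubling in \<open>Q_commutator\<close>;
    \<open>axial\<close> makes the formula linear on all matrices.\<close>
  define \<rho> :: "real^3^3 \<Rightarrow> real^'m^'m"
    where "\<rho> A = matrix (\<lambda>v. g ((1/2) *\<^sub>R Q (axial A) (k v)))" for A
  have \<rho>: "\<rho> A *v v = (1/2) *\<^sub>R g (Q (axial A) (k v))" for A v
  proof -
    have "linear (\<lambda>v. g ((1/2) *\<^sub>R Q (axial A) (k v)))"
      by (rule linearI) (simp_all add: lg lk linear_add[OF linear_Q] linear_scale[OF linear_Q]
          algebra_simps)
    then show ?thesis by (simp add: \<rho>_def matrix_works lg)
  qed
  \<comment> \<open>Passing to coordinates and back is harmless on horizontal vectors, so operators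
    compose as they do on the horizontal subspace.\<close>
  have kgQ: "k (g (Q a (k v))) = Q a (k v)" for a v
    by (simp add: kg hor_id Q_horizontal k_h)
  have rep: "so3_representation \<rho>"
    unfolding so3_representation_def lie_hom_def
  proof (intro conjI ballI allI)
    fix A B :: "real^3^3" and r :: real
    show "\<rho> (A + B) = \<rho> A + \<rho> B"
      by (simp add: matrix_eq \<rho> matrix_vector_mult_add_rdistrib linear_add[OF linear_axial] Q_left
          lg algebra_simps)
    show "\<rho> (r *\<^sub>R A) = r *\<^sub>R \<rho> A"
      by (simp add: matrix_eq \<rho> scaleR_matrix_vector_assoc[symmetric] linear_scale[OF linear_axial]
          Q_left lg)
    assume AB: "A \<in> so3" "B \<in> so3"
    have "commutator (\<rho> A) (\<rho> B) *v v = \<rho> (commutator A B) *v v" for v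
    proof -
      have "commutator (\<rho> A) (\<rho> B) *v v
          = (1/4) *\<^sub>R g (Q (axial A) (Q (axial B) (k v)) - Q (axial B) (Q (axial A) (k v)))"
        by (simp add: commutator_def matrix_vector_mult_diff_rdistrib
            flip: matrix_vector_mul_assoc)
          (simp add: \<rho> lk kgQ linear_scale[OF linear_Q] lg algebra_simps)
      also have "\<dots> = \<rho> (commutator A B) *v v"
        by (simp add: Q_commutator k_h \<rho> axial_commutator AB lg)
      finally show ?thesis .
    qed
    then show "\<rho> (commutator A B) = commutator (\<rho> A) (\<rho> B)"
      by (simp add: matrix_eq)
  qed simp
  have \<rho>\<theta>: "\<rho> (\<theta> x) *v v = c *\<^sub>R g (Q (ev x) (k v))" for x v
    by (simp add: \<rho> \<theta>_def Q_left lg)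
  have Q_xi: "Q (ev (\<xi> i)) x = \<phi> i x" if "i \<in> {1,2,3}" for i x
    using that by (auto simp: Q_def ev_def eta_xi eta_xi_numeral)
  \<comment> \<open>The factors \<open>2 * c\<close>, 1/2 and \<open>inverse c\<close> cancel,
    leaving \<open>\<phi> i\<close> in coordinates.\<close>
  have J: "inverse c *\<^sub>R (\<rho> (\<theta> (\<xi> i)) *v v) = g (\<phi> i (k v))" if "i \<in> {1,2,3}" for i v
    using that c_nonzero by (simp add: \<rho>\<theta> Q_xi)
  have k_J: "k (g (\<phi> i (k v))) = \<phi> i (k v)" if "i \<in> {1,2,3}" for i v
    using that by (simp add: kg hor_id phi_horizontal k_h)
  have lin_J: "linear (\<lambda>v. g (\<phi> i (k v)))" if "i \<in> {1,2,3}" for i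
    using linear_compose[OF linear_compose[OF k linear_phi[OF that]] g] by (simp add: o_def)
  have hyper: "hypercomplex_structure (\<lambda>i v. inverse c *\<^sub>R (\<rho> (\<theta> (\<xi> i)) *v v))"
    unfolding hypercomplex_structure_def
  proof (intro conjI ballI allI)
    show "linear (\<lambda>v. inverse c *\<^sub>R (\<rho> (\<theta> (\<xi> i)) *v v))" if "i \<in> {1,2,3}" for i
      using lin_J[OF that] by (simp only: J[OF that])
    show "inverse c *\<^sub>R (\<rho> (\<theta> (\<xi> i)) *v (inverse c *\<^sub>R (\<rho> (\<theta> (\<xi> i)) *v v))) = - v"
      if i: "i \<in> {1,2,3}" for i v
      unfolding J[OF i] k_J[OF i] phi_phi_horizontal[OF k_h i] by (simp add: lg gk)
    have m: "1 \<in> {1,2,3::nat}" "2 \<in> {1,2,3::nat}" "3 \<in> {1,2,3::nat}" by simp_all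
    note cyc = phi_cyclic[OF k_h even_perm3_cyclic(1)]
    show "inverse c *\<^sub>R (\<rho> (\<theta> (\<xi> 1)) *v (inverse c *\<^sub>R (\<rho> (\<theta> (\<xi> 2)) *v v)))
        = - (inverse c *\<^sub>R (\<rho> (\<theta> (\<xi> 2)) *v (inverse c *\<^sub>R (\<rho> (\<theta> (\<xi> 1)) *v v))))" for v
      unfolding J[OF m(1)] J[OF m(2)] k_J[OF m(1)] k_J[OF m(2)] cyc by (simp add: lg)
    show "inverse c *\<^sub>R (\<rho> (\<theta> (\<xi> 1)) *v (inverse c *\<^sub>R (\<rho> (\<theta> (\<xi> 2)) *v v)))
        = inverse c *\<^sub>R (\<rho> (\<theta> (\<xi> 3)) *v v)" for v
      unfolding J[OF m(1)] J[OF m(2)] J[OF m(3)] k_J[OF m(2)] cyc ..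
  qed
  \<comment> \<open>The kernels of \<open>\<theta>\<close> and \<open>g\<close> are the horizontal
    and the vertical subspace, which are complementary.\<close>
  define f where "f x = (\<theta> x, g x)" for x
  have "bij_betw f UNIV (so3 \<times> UNIV)"
  proof (rule bij_betwI[where g = "\<lambda>p. V (inverse (2 * c) *\<^sub>R axial (fst p)) + k (snd p)"])
    show "f \<in> UNIV \<rightarrow> so3 \<times> UNIV" by (auto simp: f_def \<theta>_def hat_so3)
    show "V (inverse (2 * c) *\<^sub>R axial (fst (f x))) + k (snd (f x)) = x" for x
      using c_nonzero by (simp add: f_def \<theta>_def kg V_ev_hor)
    show "f (V (inverse (2 * c) *\<^sub>R axial (fst p)) + k (snd p)) = p" if "p \<in> so3 \<times> UNIV" for p
      using that c_nonzero
      by (auto simp: f_def \<theta>_def lg g_V gk linear_add[OF linear_ev] ev_horizontal k_h hat_axial)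
  qed simp
  moreover have "g (br x y) = \<rho> (\<theta> x) *v g y - \<rho> (\<theta> y) *v g x" for x y
    by (simp add: br_eq lg g_V \<rho>\<theta> kg algebra_simps)
  then have "f (br x y) = semidirect_bracket \<rho> (f x) (f y)" for x y
    by (simp add: f_def semidirect_bracket_def theta_br)
  ultimately have "lie_iso UNIV br (so3 \<times> UNIV) (semidirect_bracket \<rho>) f"
    unfolding lie_iso_def lie_hom_def
    by (simp add: bij_betw_apply) (simp add: f_def linear_add[OF linear_theta]
        linear_scale[OF linear_theta] lg)
  moreover have "\<forall>x\<in>vertical \<xi>. f x = (\<theta> x, 0)"
    by (auto simp: vertical_eq f_def g_V)
  moreover have "f ` horizontal \<eta> = {0} \<times> UNIV"
  proof -
    have f_h: "f x = (0, g x)" if "x \<in> horizontal \<eta>" for x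
      using that by (simp add: f_def \<theta>_def ev_horizontal linear_0[OF linear_hat])
    have "(0, v) = f (k v)" for v
      by (simp add: f_h k_h gk)
    then have "{0} \<times> UNIV \<subseteq> f ` horizontal \<eta>"
      using k_h by blast
    then show ?thesis using f_h by auto
  qed
  ultimately show ?thesis using rep hyper by blast
qed

end

theorem proposition5p1:
  fixes br :: "'a::real_vector \<Rightarrow> 'a \<Rightarrow> 'a"
    and \<phi> :: "nat \<Rightarrow> 'a \<Rightarrow> 'a" and \<xi> :: "nat \<Rightarrow> 'a" and \<eta> :: "nat \<Rightarrow> 'a \<Rightarrow> real"
    and n :: nat
  assumes "almost_3_contact_lie_algebra n br \<phi> \<xi> \<eta>"
    and "abelian_3_structure br \<phi> \<xi> \<eta>"
    and "bij_betw (psi br \<phi> \<xi>) (horizontal \<eta>) (horizontal \<eta>)"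
  shows "\<exists>\<delta>::real. \<delta> \<noteq> 0 \<and>
    lie_subalgebra br (vertical \<xi>) \<and>
    (\<exists>\<theta>. lie_iso (vertical \<xi>) br so3 commutator \<theta>) \<and>
    lie_ideal br (horizontal \<eta>) \<and> abelian_on br (horizontal \<eta>) \<and>
    (\<forall>i j k. even_perm3 i j k \<longrightarrow>
       br (\<xi> i) (\<xi> j) = (2 * \<delta>) *\<^sub>R \<xi> k \<and>
       (\<forall>x\<in>horizontal \<eta>. br (\<xi> i) x = \<delta> *\<^sub>R \<phi> i x)) \<and>
    (CARD('m::finite) = 4 * n \<longrightarrow>
      (\<exists>(\<theta> :: 'a \<Rightarrow> real^3^3) (\<rho> :: real^3^3 \<Rightarrow> real^'m^'m) (f :: 'a \<Rightarrow> (real^3^3) \<times> (real^'m)).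
         lie_iso (vertical \<xi>) br so3 commutator \<theta> \<and>
         so3_representation \<rho> \<and>
         hypercomplex_structure (\<lambda>i v. inverse \<delta> *\<^sub>R (\<rho> (\<theta> (\<xi> i)) *v v)) \<and>
         lie_iso UNIV br (so3 \<times> UNIV) (semidirect_bracket \<rho>) f \<and>
         (\<forall>x\<in>vertical \<xi>. f x = (\<theta> x, 0)) \<and>
         f ` horizontal \<eta> = {0} \<times> UNIV))"
proof -
  interpret abelian_3_contact n br \<phi> \<xi> \<eta>
    using assms(1,2) by unfold_locales
  \<comment> \<open>Invertibility of \<open>\<psi>\<close> enters here and supplies the assumptions
    of \<open>so3_contact\<close>.\<close>
  obtain c where c: "c \<noteq> 0"
    and br_xi: "\<And>i j k. even_perm3 i j k \<Longrightarrow> br (\<xi> i) (\<xi> j) = (2 * c) *\<^sub>R \<xi> k"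
    and br_h: "\<And>i x. i \<in> {1,2,3} \<Longrightarrow> x \<in> horizontal \<eta> \<Longrightarrow> br (\<xi> i) x = c *\<^sub>R \<phi> i x"
    by (rule structure_constant[OF assms(3)]) (rule that; blast)
  interpret so3_contact n br \<phi> \<xi> \<eta> c
    using c br_xi br_h by unfold_locales
  show ?thesis
  proof (intro exI[of _ c] conjI allI impI ballI)
    show "\<exists>\<theta>. lie_iso (vertical \<xi>) br so3 commutator \<theta>"
      using theta_iso by blast
    show "br (\<xi> i) x = c *\<^sub>R \<phi> i x" if "even_perm3 i j k" "x \<in> horizontal \<eta>" for i j k x
      using br_h even_perm3_mem[OF that(1)] that(2) by blast
    assume card: "CARD('m) = 4 * n"
    show "\<exists>(\<theta> :: 'a \<Rightarrow> real^3^3) (\<rho> :: real^3^3 \<Rightarrow> real^'m^'m) (f :: 'a \<Rightarrow> (real^3^3) \<times> (real^'m)).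
         lie_iso (vertical \<xi>) br so3 commutator \<theta> \<and>
         so3_representation \<rho> \<and>
         hypercomplex_structure (\<lambda>i v. inverse c *\<^sub>R (\<rho> (\<theta> (\<xi> i)) *v v)) \<and>
         lie_iso UNIV br (so3 \<times> UNIV) (semidirect_bracket \<rho>) f \<and>
         (\<forall>x\<in>vertical \<xi>. f x = (\<theta> x, 0)) \<and>
         f ` horizontal \<eta> = {0} \<times> UNIV"
      using theta_iso semidirect_iso[OF card] by blast
  qed (use c br_xi vertical_subalgebra horizontal_ideal horizontal_abelian in simp_all)
qed

end
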